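(* There exist constants $\alpha_{a_h},\alpha_{a_\varepsilon}>0$, independent of $h$ and $\varepsilon$, such that for every $h>0$ and $\varepsilon>0$ $$a_h(\mathbf v_h,\mathbf v_h)\ge\alpha_{a_h}\|\mathbf v_h\|_{0,h}^2\quad\forall\,\mathbf v_h\in V_h,\qquad a_\varepsilon(\mathbf v_h,\mathbf v_h)\ge\alpha_{a_\varepsilon}\|\mathbf v_h\|_{0,h,\varepsilon}^2\quad\forall\,\mathbf v_h\in V_h.$$
   Context: $\Omega\subset\mathbb R^d$, $d\in\{2,3\}$, is a bounded connected open set with Lipschitz boundary $\Gamma=\Gamma_N\cup\Gamma_D$, $\Gamma_N\cap\Gamma_D=\emptyset$, with outward unit normal $\mathbf n$. $(\cdot,\cdot)_D$ and $\langle\cdot,\cdot\rangle_\gamma$ denote $L^2$ inner products on volumes $D$ and surfaces $\gamma$. Mesh: $(\mathcal T_h)_{h>0}$ is a family of triangular (simplicial) or quadrilateral (cubical) meshes of $\Omega$; $h_K=\operatorname{diam}K$, $h=\max_{K\in\mathcal T_h}h_K$; it is shape-regular ($h_K/\rho_K\le\sigma$, $\rho_K$ the diameter of the largest ball inscribed in $K$, $\sigma$ independent of $h$) and quasi-uniform ($\min_K h_K\ge\tau h$, $\tau>0$ independent of $h$). $\mathcal F_h^\partial(\Gamma_N)$ is the set of boundary facets lying on $\Gamma_N$. Space: fix an integer $k\ge0$. $\hat K$ is the unit $d$-simplex (triangular meshes) or $[0,1]^d$ (quadrilateral meshes), and $F_K:\hat K\to K$, $F_K(\hat x)=B_K\hat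 x+b_K$, is affine with $B_K$ invertible (diagonal for quadrilateral meshes). $\mathbb P_k$ are polynomials of degree at most $k$, $\tilde{\mathbb P}_k$ homogeneous polynomials of degree $k$, and $\mathbb Q_{r,s}$, $\mathbb Q_{r,s,t}$ polynomials of degree at most $r,s,t$ in the successive variables. For simplices $\mathbb{RT}_k(\hat K)=\mathbb P_k(\hat K)^d\oplus\mathbf x\,\tilde{\mathbb P}_k(\hat K)$; for quadrilaterals $\mathbb{RT}_k(\hat K)=\mathbb Q_{k+1,k}\times\mathbb Q_{k,k+1}$ if $d=2$ and $\mathbb Q_{k+1,k,k}\times\mathbb Q_{k,k+1,k}\times\mathbb Q_{k,k,k+1}$ if $d=3$. $\mathbb{RT}_k(K)$ is the image of $\mathbb{RT}_k(\hat K)$ under the Piola transform $\hat{\mathbf u}\mapsto|\det B_K|^{-1}B_K\,\hat{\mathbf u}\circ F_K^{-1}$. $V_h=\{\mathbf v_h\in \mathbf H(\operatorname{div};\Omega):\mathbf v_h|_K\in\mathbb{RT}_k(K)\ \forall K\in\mathcal T_h\}$. Forms and norms, for $\varepsilon>0$: $a_h(\mathbf u_h,\mathbf v_h)=(\mathbf u_h,\mathbf v_h)_\Omega+h^{-1}\langle\mathbf u_h\cdot\mathbf n,\mathbf v_h\cdot\mathbf n\rangle_{\Gamma_N}$; $a_\varepsilon(\mathbf u_h,\mathbf v_h)=(\mathbf u_h,\mathbf v_h)_\Omega+\varepsilon^{-1}\langle\mathbf u_h\cdot\mathbf n,\mathbf v_h\cdot\mathbf n\rangle_{\Gamma_N}$;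 $\|\mathbf v_h\|_{0,h}^2=\|\mathbf v_h\|_{L^2(\Omega)}^2+\sum_{f\in\mathcal F_h^\partial(\Gamma_N)}h^{-1}\|\mathbf v_h\cdot\mathbf n\|_{L^2(f)}^2$; $\|\mathbf v_h\|_{0,h,\varepsilon}^2=\|\mathbf v_h\|_{L^2(\Omega)}^2+\sum_{f\in\mathcal F_h^\partial(\Gamma_N)}\varepsilon^{-1}\|\mathbf v_h\cdot\mathbf n\|_{L^2(f)}^2$. *)

theory Defs
  imports "HOL-Analysis.Analysis"
begin

section \<open>Surface measure\<close>

text \<open>
  The diameter of an unbounded set is unspecified in the library, so the covering sets are
  required to be bounded. The summand is guarded so that the empty set contributes 0 also for
  \<open>s = 0\<close>.
\<close>

definition hausdorff_outer :: "nat \<Rightarrow> 'a::metric_space set \<Rightarrow> ennreal" where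
  "hausdorff_outer s A =
    (SUP \<delta>\<in>{0<..}.
      INF C\<in>{C :: nat \<Rightarrow> 'a set. A \<subseteq> (\<Union>i. C i) \<and> (\<forall>i. bounded (C i) \<and> diameter (C i) \<le> \<delta>)}.
        (\<Sum>i. if C i = {} then 0
              else ennreal (unit_ball_vol (real s) * (diameter (C i) / 2) ^ s)))"

text \<open>
  The \<open>(d - 1)\<close>-dimensional Hausdorff measure on \<open>\<real>\<^sup>d\<close>, completed. A Hausdorff outer measure
  is a metric outer measure, hence countably additive on the Borel sets, so that
  \<^const>\<open>measure_of\<close> does not fall back to the null measure.
\<close>

definition surface_measure :: "(real^'n) measure" where
  "surface_measure =
    completion (measure_of UNIV (sets borel) (hausdorff_outer (CARD('n) - 1)))"

section \<open>Lipschitz domains and their outward normal\<close>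

text \<open>
  Near each boundary point \<open>\<Omega>\<close> is the region below the graph of a Lipschitz function, in
  Cartesian coordinates whose last axis is \<open>\<nu>\<close>; the remaining coordinates of \<open>y\<close> are
  represented by the orthogonal projection \<open>y - (y \<bullet> \<nu>) \<nu>\<close>.
\<close>

definition lipschitz_boundary :: "(real^'n) set \<Rightarrow> bool" where
  "lipschitz_boundary \<Omega> \<longleftrightarrow>
    (\<forall>x\<in>frontier \<Omega>. \<exists>U \<nu> L (\<phi> :: real^'n \<Rightarrow> real).
      open U \<and> x \<in> U \<and> norm \<nu> = 1 \<and> L-lipschitz_on {z. z \<bullet> \<nu> = 0} \<phi> \<and>
      \<Omega> \<inter> U = {y\<in>U. y \<bullet> \<nu> < \<phi> (y - (y \<bullet> \<nu>) *\<^sub>R \<nu>)})"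

text \<open>
  \<open>\<Omega>\<close> is, to first order at \<open>x\<close>, the half-space \<open>{y. (y - x) \<bullet> \<nu> < 0}\<close>. If
  \<open>\<Omega>\<close> is locally the region below the graph of a Lipschitz function, this says that the function is
  differentiable at the base point of \<open>x\<close> and that \<open>\<nu>\<close> is its upward unit normal there.
\<close>

definition is_outward_unit_normal :: "(real^'n) set \<Rightarrow> real^'n \<Rightarrow> real^'n \<Rightarrow> bool" where
  "is_outward_unit_normal \<Omega> x \<nu> \<longleftrightarrow>
    norm \<nu> = 1 \<and>
    (\<forall>e>0. \<exists>r>0. \<forall>y\<in>ball x r.
      ((y - x) \<bullet> \<nu> < - e * norm (y - x) \<longrightarrow> y \<in> \<Omega>) \<and>
      ((y - x) \<bullet> \<nu> > e * norm (y - x) \<longrightarrow> y \<notin> \<Omega>))"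

text \<open>The normal is unique where it exists, which is almost everywhere on a Lipschitz boundary.\<close>

definition outward_normal :: "(real^'n) set \<Rightarrow> real^'n \<Rightarrow> real^'n" where
  "outward_normal \<Omega> x = (THE \<nu>. is_outward_unit_normal \<Omega> x \<nu>)"

section \<open>Function spaces on the domain\<close>

definition inner_vol :: "(real^'n) set \<Rightarrow> (real^'n \<Rightarrow> real^'n) \<Rightarrow> (real^'n \<Rightarrow> real^'n) \<Rightarrow> real" where
  "inner_vol D u v = set_lebesgue_integral lebesgue D (\<lambda>x. u x \<bullet> v x)"

definition norm_vol :: "(real^'n) set \<Rightarrow> (real^'n \<Rightarrow> real^'n) \<Rightarrow> real" where
  "norm_vol D v = sqrt (inner_vol D v v)"

definition inner_surf :: "(real^'n) set \<Rightarrow> (real^'n \<Rightarrow> real) \<Rightarrow> (real^'n \<Rightarrow> real) \<Rightarrow> real" where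
  "inner_surf \<gamma> p q = set_lebesgue_integral surface_measure \<gamma> (\<lambda>x. p x * q x)"

definition norm_surf :: "(real^'n) set \<Rightarrow> (real^'n \<Rightarrow> real) \<Rightarrow> real" where
  "norm_surf \<gamma> p = sqrt (inner_surf \<gamma> p p)"

definition L2_on :: "(real^'n) set \<Rightarrow> (real^'n \<Rightarrow> 'b::euclidean_space) \<Rightarrow> bool" where
  "L2_on \<Omega> f \<longleftrightarrow> set_borel_measurable lebesgue \<Omega> f \<and>
    set_integrable lebesgue \<Omega> (\<lambda>x. (norm (f x))\<^sup>2)"

definition partial_deriv :: "'n \<Rightarrow> (real^'n \<Rightarrow> real) \<Rightarrow> real^'n \<Rightarrow> real" where
  "partial_deriv i f x = frechet_derivative f (at x) (axis i 1)"

primrec Ck_function :: "nat \<Rightarrow> (real^'n \<Rightarrow> real) \<Rightarrow> bool" where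
  "Ck_function 0 f \<longleftrightarrow> continuous_on UNIV f"
| "Ck_function (Suc m) f \<longleftrightarrow>
    (\<forall>x. f differentiable (at x)) \<and> (\<forall>i. Ck_function m (partial_deriv i f))"

definition test_function :: "(real^'n) set \<Rightarrow> (real^'n \<Rightarrow> real) \<Rightarrow> bool" where
  "test_function \<Omega> \<phi> \<longleftrightarrow> (\<forall>m. Ck_function m \<phi>) \<and>
    compact (closure {x. \<phi> x \<noteq> 0}) \<and> closure {x. \<phi> x \<noteq> 0} \<subseteq> \<Omega>"

definition weak_divergence ::
    "(real^'n) set \<Rightarrow> (real^'n \<Rightarrow> real^'n) \<Rightarrow> (real^'n \<Rightarrow> real) \<Rightarrow> bool" where
  "weak_divergence \<Omega> v g \<longleftrightarrow>
    (\<forall>\<phi>. test_function \<Omega> \<phi> \<longrightarrow>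
      set_lebesgue_integral lebesgue \<Omega> (\<lambda>x. v x \<bullet> (\<chi> i. partial_deriv i \<phi> x)) =
      - set_lebesgue_integral lebesgue \<Omega> (\<lambda>x. g x * \<phi> x))"

definition Hdiv :: "(real^'n) set \<Rightarrow> (real^'n \<Rightarrow> real^'n) set" where
  "Hdiv \<Omega> = {v. L2_on \<Omega> v \<and> (\<exists>g. L2_on \<Omega> g \<and> weak_divergence \<Omega> v g)}"

section \<open>Polynomials and Raviart--Thomas spaces\<close>

definition polys_with_exponents :: "('n \<Rightarrow> nat) set \<Rightarrow> (real^'n \<Rightarrow> real) set" where
  "polys_with_exponents E = {p. \<exists>c. p = (\<lambda>x. \<Sum>\<alpha>\<in>E. c \<alpha> * (\<Prod>i\<in>UNIV. x $ i ^ \<alpha> i))}"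

definition polyP :: "nat \<Rightarrow> (real^'n \<Rightarrow> real) set" where
  "polyP k = polys_with_exponents {\<alpha>. (\<Sum>i\<in>UNIV. \<alpha> i) \<le> k}"

definition polyP_hom :: "nat \<Rightarrow> (real^'n \<Rightarrow> real) set" where
  "polyP_hom k = polys_with_exponents {\<alpha>. (\<Sum>i\<in>UNIV. \<alpha> i) = k}"

definition polyQ :: "('n \<Rightarrow> nat) \<Rightarrow> (real^'n \<Rightarrow> real) set" where
  "polyQ r = polys_with_exponents {\<alpha>. \<forall>i. \<alpha> i \<le> r i}"

datatype cell_type = Simplicial | Cubical

primrec reference_cell :: "cell_type \<Rightarrow> (real^'n) set" where
  "reference_cell Simplicial = convex hull (insert 0 Basis)"
| "reference_cell Cubical = cbox 0 One"

text \<open>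
  In the cubical case the \<open>i\<close>-th component has degree at most \<open>k + 1\<close> in the \<open>i\<close>-th variable and
  at most \<open>k\<close> in the others.
\<close>

primrec RT_ref :: "cell_type \<Rightarrow> nat \<Rightarrow> (real^'n \<Rightarrow> real^'n) set" where
  "RT_ref Simplicial k =
    {\<lambda>x. p x + q x *\<^sub>R x | p q. (\<forall>i. (\<lambda>x. p x $ i) \<in> polyP k) \<and> q \<in> polyP_hom k}"
| "RT_ref Cubical k = {p. \<forall>i. (\<lambda>x. p x $ i) \<in> polyQ ((\<lambda>j. k)(i := k + 1))}"

definition affine_map :: "real^'n^'n \<Rightarrow> real^'n \<Rightarrow> real^'n \<Rightarrow> real^'n" where
  "affine_map B b x = B *v x + b"

definition piola :: "real^'n^'n \<Rightarrow> real^'n \<Rightarrow> (real^'n \<Rightarrow> real^'n) \<Rightarrow> real^'n \<Rightarrow> real^'n" where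
  "piola B b u x = inverse \<bar>det B\<bar> *\<^sub>R (B *v u (inv (affine_map B b) x))"

definition RT_cell ::
    "cell_type \<Rightarrow> nat \<Rightarrow> real^'n^'n \<Rightarrow> real^'n \<Rightarrow> (real^'n \<Rightarrow> real^'n) set" where
  "RT_cell c k B b = piola B b ` RT_ref c k"

section \<open>Meshes\<close>

definition is_cell_map :: "cell_type \<Rightarrow> (real^'n) set \<Rightarrow> real^'n^'n \<Rightarrow> real^'n \<Rightarrow> bool" where
  "is_cell_map c K B b \<longleftrightarrow> invertible B \<and>
    (c = Cubical \<longrightarrow> (\<forall>i j. i \<noteq> j \<longrightarrow> B $ i $ j = 0)) \<and>
    K = affine_map B b ` reference_cell c"

text \<open>
  Conforming meshes with closed cells; \<open>B K\<close> and \<open>b K\<close> describe the chosen map from the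
  reference cell onto \<open>K\<close>.
\<close>

definition mesh_of ::
    "cell_type \<Rightarrow> (real^'n) set \<Rightarrow> (real^'n) set set \<Rightarrow>
      ((real^'n) set \<Rightarrow> real^'n^'n) \<Rightarrow> ((real^'n) set \<Rightarrow> real^'n) \<Rightarrow> bool" where
  "mesh_of c \<Omega> T B b \<longleftrightarrow>
    finite T \<and> T \<noteq> {} \<and> \<Union>T = closure \<Omega> \<and>
    (\<forall>K\<in>T. is_cell_map c K (B K) (b K)) \<and>
    (\<forall>K\<in>T. \<forall>K'\<in>T. K \<inter> K' face_of K \<and> K \<inter> K' face_of K')"

definition inball_diameter :: "(real^'n) set \<Rightarrow> real" where
  "inball_diameter K = Sup {2 * r | r. r \<ge> 0 \<and> (\<exists>x. cball x r \<subseteq> K)}"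

definition mesh_size :: "(real^'n) set set \<Rightarrow> real" where
  "mesh_size T = Max (diameter ` T)"

definition shape_regular :: "real set \<Rightarrow> (real \<Rightarrow> (real^'n) set set) \<Rightarrow> bool" where
  "shape_regular H T \<longleftrightarrow> (\<exists>\<sigma>. \<forall>h\<in>H. \<forall>K\<in>T h. diameter K / inball_diameter K \<le> \<sigma>)"

definition quasi_uniform :: "real set \<Rightarrow> (real \<Rightarrow> (real^'n) set set) \<Rightarrow> bool" where
  "quasi_uniform H T \<longleftrightarrow> (\<exists>\<tau>>0. \<forall>h\<in>H. Min (diameter ` T h) \<ge> \<tau> * h)"

text \<open>
  A closed facet lies on \<open>\<gamma>\<close> if its relative interior is contained in \<open>\<gamma>\<close>: the closed facets
  meeting the interface between the two disjoint parts of the boundary cannot all be contained in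
  one part.
\<close>

definition boundary_facets_on ::
    "(real^'n) set \<Rightarrow> (real^'n) set set \<Rightarrow> (real^'n) set \<Rightarrow> (real^'n) set set" where
  "boundary_facets_on \<Omega> T \<gamma> =
    {f. (\<exists>K\<in>T. f facet_of K) \<and> f \<subseteq> frontier \<Omega> \<and> rel_interior f \<subseteq> \<gamma>}"

section \<open>Discrete space, forms and norms\<close>

text \<open>
  Elements of \<open>H(div)\<close> are classes of functions modulo null sets; an element of the discrete space
  is given by a representative that is a polynomial on the interior of each cell. Its values on
  the cell boundaries are irrelevant.
\<close>

definition RT_space ::
    "cell_type \<Rightarrow> nat \<Rightarrow> (real^'n) set \<Rightarrow> (real^'n) set set \<Rightarrow>
      ((real^'n) set \<Rightarrow> real^'n^'n) \<Rightarrow> ((real^'n) set \<Rightarrow> real^'n) \<Rightarrow>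
      (real^'n \<Rightarrow> real^'n) set" where
  "RT_space c k \<Omega> T B b =
    {v \<in> Hdiv \<Omega>. \<forall>K\<in>T. \<exists>w\<in>RT_cell c k (B K) (b K). \<forall>x\<in>interior K. v x = w x}"

text \<open>
  The normal trace from inside. In the relative interior of a boundary facet of a cell \<open>K\<close>, the
  limit is the value of the polynomial that \<open>v\<close> equals on \<open>K\<close>.
\<close>

definition normal_trace :: "(real^'n) set \<Rightarrow> (real^'n \<Rightarrow> real^'n) \<Rightarrow> real^'n \<Rightarrow> real" where
  "normal_trace \<Omega> v x = Lim (at x within \<Omega>) v \<bullet> outward_normal \<Omega> x"

text \<open>
  With \<open>s = h\<close> the following form and norm are \<open>a\<^sub>h\<close> and the norm with subscript \<open>0,h\<close>; with \<open>s = \<epsilon>\<close> they are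
  \<open>a\<^sub>\<epsilon>\<close> and the norm with subscript \<open>0,h,\<epsilon>\<close>.
\<close>

definition form_a ::
    "(real^'n) set \<Rightarrow> (real^'n) set \<Rightarrow> real \<Rightarrow>
      (real^'n \<Rightarrow> real^'n) \<Rightarrow> (real^'n \<Rightarrow> real^'n) \<Rightarrow> real" where
  "form_a \<Omega> \<gamma> s u v =
    inner_vol \<Omega> u v + inverse s * inner_surf \<gamma> (normal_trace \<Omega> u) (normal_trace \<Omega> v)"

definition norm_0 ::
    "(real^'n) set \<Rightarrow> (real^'n) set set \<Rightarrow> (real^'n) set \<Rightarrow> real \<Rightarrow> (real^'n \<Rightarrow> real^'n) \<Rightarrow> real" where
  "norm_0 \<Omega> T \<gamma> s v =
    sqrt ((norm_vol \<Omega> v)\<^sup>2 +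
      (\<Sum>f\<in>boundary_facets_on \<Omega> T \<gamma>. inverse s * (norm_surf f (normal_trace \<Omega> v))\<^sup>2))"

end

theory Submission
  imports Defs
begin

text \<open>
  Both constants are 1: the form and the squared norm have the same volume part, and the relative
  interiors of the boundary facets on \<open>\<Gamma>\<^sub>N\<close> are disjoint subsets of \<open>\<Gamma>\<^sub>N\<close>. What needs an argument is
  that the squared normal trace is integrable over all of \<open>\<Gamma>\<^sub>N\<close>, since the Bochner integral of a
  non-integrable function is 0. A Lipschitz domain is the interior of its closure, so a boundary point
  in the relative interior of a facet lies in one cell only. There the domain is locally a
  half-space, hence the normal is constant and the trace agrees with a continuous function. Facets
  have finite Hausdorff measure and their relative frontiers are null, by counting covers with
  cubes.
\<close>

section \<open>Hausdorff measure of low-dimensional sets\<close>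

text \<open>A finite cover is padded with empty sets to a sequence; the guard in the summand makes
  the padding contribute 0. The bound \<open>c\<close> has to hold at every scale \<delta>, since
  the outer measure is a supremum over \<delta>.\<close>

lemma hausdorff_outer_le_cover:
  fixes A :: "'a::metric_space set"
  assumes cover: "\<And>\<delta>. \<delta> > 0 \<Longrightarrow> \<exists>\<D> r. finite \<D> \<and> A \<subseteq> \<Union>\<D> \<and> 0 \<le> r \<and> r \<le> \<delta> \<and>
      (\<forall>D\<in>\<D>. bounded D \<and> diameter D \<le> r) \<and>
      real (card \<D>) * (unit_ball_vol (real s) * (r / 2) ^ s) \<le> c"
  shows "hausdorff_outer s A \<le> ennreal c"
  unfolding hausdorff_outer_def
proof (rule SUP_least)
  fix \<delta> :: real assume "\<delta> \<in> {0<..}"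
  then have "\<delta> > 0" by simp
  then obtain \<D> r where \<D>: "finite \<D>" "A \<subseteq> \<Union>\<D>" "0 \<le> r" "r \<le> \<delta>"
      "\<And>D. D \<in> \<D> \<Longrightarrow> bounded D \<and> diameter D \<le> r"
      "real (card \<D>) * (unit_ball_vol (real s) * (r / 2) ^ s) \<le> c"
    using cover by meson
  obtain e where e: "bij_betw e {..<card \<D>} \<D>"
    using \<D>(1) bij_betw_from_nat_into_finite by blast
  define C where "C i = (if i < card \<D> then e i else {})" for i
  have Ci: "C i \<in> \<D>" if "i < card \<D>" for i
    using e that by (auto simp: C_def bij_betw_def)
  let ?w = "\<lambda>i. if C i = {} then 0
              else ennreal (unit_ball_vol (real s) * (diameter (C i) / 2) ^ s)"
  have "(INF C\<in>{C :: nat \<Rightarrow> 'a set. A \<subseteq> (\<Union>i. C i) \<and> (\<forall>i. bounded (C i) \<and> diameter (C i) \<le> \<delta>)}.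
        (\<Sum>i. if C i = {} then 0
              else ennreal (unit_ball_vol (real s) * (diameter (C i) / 2) ^ s))) \<le> (\<Sum>i. ?w i)"
  proof (rule INF_lower, clarsimp, intro conjI allI)
    show "A \<subseteq> (\<Union>i. C i)"
    proof
      fix x assume "x \<in> A"
      then obtain D where "D \<in> \<D>" "x \<in> D" using \<D>(2) by blast
      then have "D \<in> e ` {..<card \<D>}" using bij_betw_imp_surj_on[OF e] by simp
      then obtain i where "i < card \<D>" "e i = D" by auto
      then show "x \<in> (\<Union>i. C i)" using \<open>x \<in> D\<close> by (auto simp: C_def)
    qed
  next
    fix i
    show "bounded (C i)"
      using \<D>(5) Ci by (cases "i < card \<D>") (auto simp: C_def)
    show "diameter (C i) \<le> \<delta>"
      using \<D>(3,4,5) Ci[of i] \<open>\<delta> > 0\<close> by (cases "i < card \<D>") (force simp: C_def)+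
  qed
  also have "(\<Sum>i. ?w i) = (\<Sum>i<card \<D>. ?w i)"
    by (rule suminf_finite) (auto simp: C_def)
  also have "\<dots> \<le> (\<Sum>i<card \<D>. ennreal (unit_ball_vol (real s) * (r / 2) ^ s))"
  proof (intro sum_mono)
    fix i assume "i \<in> {..<card \<D>}"
    then have "bounded (C i)" "diameter (C i) \<le> r"
      using \<D>(5) Ci by auto
    then show "?w i \<le> ennreal (unit_ball_vol (real s) * (r / 2) ^ s)"
      by (auto intro!: ennreal_leI mult_left_mono power_mono divide_right_mono diameter_ge_0)
  qed
  also have "\<dots> = ennreal (real (card \<D>) * (unit_ball_vol (real s) * (r / 2) ^ s))"
    using \<D>(3) by (simp add: ennreal_mult'' ennreal_of_nat_eq_real_of_nat)
  also have "\<dots> \<le> ennreal c"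
    using \<D>(6) by (rule ennreal_leI)
  finally show "(INF C\<in>{C :: nat \<Rightarrow> 'a set. A \<subseteq> (\<Union>i. C i) \<and> (\<forall>i. bounded (C i) \<and> diameter (C i) \<le> \<delta>)}.
        (\<Sum>i. if C i = {} then 0
              else ennreal (unit_ball_vol (real s) * (diameter (C i) / 2) ^ s))) \<le> ennreal c" .
qed

text \<open>In an orthonormal basis of the direction space of the affine hull, \<open>A\<close> lies
  in a cube with at most \<open>m\<close> axes. Cutting each axis into \<open>N\<close> equal parts
  gives the pieces, and \<open>C\<close> depends on \<open>A\<close> alone.\<close>

lemma bounded_low_dim_cover:
  fixes A :: "'a::euclidean_space set"
  assumes "bounded A" "aff_dim A \<le> int m"
  obtains C where "C \<ge> 0"
    and "\<And>N::nat. N > 0 \<Longrightarrow> \<exists>\<D>. finite \<D> \<and> card \<D> \<le> N ^ m \<and> A \<subseteq> \<Union>\<D> \<and>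
           (\<forall>D\<in>\<D>. bounded D \<and> diameter D \<le> C / real N)"
proof (cases "A = {}")
  case True
  then show ?thesis by (intro that[of 0]) (auto intro!: exI[of _ "{}"])
next
  case False
  then obtain a where a: "a \<in> A" by blast
  define V where "V = span ((+) (- a) ` A)"
  obtain Bs where Bs: "pairwise orthogonal Bs" "\<And>x. x \<in> Bs \<Longrightarrow> norm x = 1"
      "independent Bs" "card Bs = dim V" "span Bs = V"
    using orthonormal_basis_subspace[of V] unfolding V_def by (metis subspace_span)
  have "int (dim V) = aff_dim A"
    using a by (subst aff_dim_eq_dim[of a]) (auto simp: V_def hull_inc)
  then have card: "card Bs \<le> m" using Bs(4) assms(2) by linarith
  have fin: "finite Bs" using Bs(3) by (rule independent_imp_finite)
  have diffV: "x - y \<in> span Bs" if "x \<in> A" "y \<in> A" for x y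
  proof -
    have "(x - a) - (y - a) \<in> V"
      unfolding V_def using that by (intro span_diff span_base) auto
    then show ?thesis using Bs(5) by simp
  qed
  obtain R0 where R0: "\<And>x. x \<in> A \<Longrightarrow> norm x \<le> R0"
    using assms(1) unfolding bounded_iff by blast
  \<comment> \<open>The extra 1 makes the bound on \<open>norm (x - a)\<close> strict, so that
    rescaled coordinates stay below \<open>N\<close> and their floors are valid box indices. It also
    keeps \<open>R\<close> positive if \<open>A\<close> is a single point.\<close>
  define R where "R = R0 + norm a + 1"
  have R: "norm (x - a) < R" if "x \<in> A" for x
    using R0[OF that] norm_triangle_ineq4[of x a] by (simp add: R_def)
  have "R > 0" using R[OF a] by simp
  show ?thesis
  proof (rule that[of "real (card Bs) * (2 * R)"])
    show "0 \<le> real (card Bs) * (2 * R)" using \<open>R > 0\<close> by simp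
    fix N :: nat assume "N > 0"
    \<comment> \<open>The affine rescaling sends coordinates in \<open>(-R, R)\<close> to
      \<open>(0, N)\<close>; \<open>D g\<close> is the part of \<open>A\<close> in the closed unit
      box with lower corner \<open>g\<close>. Overlaps of the boxes are harmless for a
      cover.\<close>
    define D where "D g = {x\<in>A. \<forall>v\<in>Bs. real (g v) \<le> ((x - a) \<bullet> v + R) * N / (2 * R) \<and>
        ((x - a) \<bullet> v + R) * N / (2 * R) \<le> real (g v) + 1}" for g :: "'a \<Rightarrow> nat"
    let ?G = "PiE Bs (\<lambda>_. {..<N})"
    have "card (D ` ?G) \<le> card ?G" by (rule card_image_le) (simp add: fin finite_PiE)
    also have "\<dots> = N ^ card Bs" by (simp add: card_PiE fin)
    also have "\<dots> \<le> N ^ m" using card \<open>N > 0\<close> by (simp add: power_increasing)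
    finally have "card (D ` ?G) \<le> N ^ m" .
    moreover have "A \<subseteq> \<Union>(D ` ?G)"
    proof
      fix x assume x: "x \<in> A"
      define t where "t v = ((x - a) \<bullet> v + R) * N / (2 * R)" for v
      define g where "g = restrict (\<lambda>v. nat \<lfloor>t v\<rfloor>) Bs"
      have t: "0 < t v" "t v < real N" if "v \<in> Bs" for v
      proof -
        have "\<bar>(x - a) \<bullet> v\<bar> < R"
          using Cauchy_Schwarz_ineq2[of "x - a" v] Bs(2)[OF that] R[OF x] by simp
        then have "0 < (x - a) \<bullet> v + R" "(x - a) \<bullet> v + R < 2 * R" by linarith+
        then show "0 < t v" "t v < real N"
          using \<open>N > 0\<close> \<open>R > 0\<close> unfolding t_def
          by (simp_all add: pos_divide_less_eq)
      qed
      have "g \<in> ?G"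
        unfolding g_def
      proof (rule restrict_PiE_iff[THEN iffD2], rule ballI)
        fix v assume "v \<in> Bs"
        then show "nat \<lfloor>t v\<rfloor> \<in> {..<N}"
          using t[of v] by (auto simp: nat_less_iff floor_less_iff)
      qed
      moreover have "x \<in> D g"
        unfolding D_def
      proof (intro CollectI conjI ballI x)
        fix v assume v: "v \<in> Bs"
        have "real (g v) = of_int \<lfloor>t v\<rfloor>" using v t[of v] by (simp add: g_def)
        then show "real (g v) \<le> ((x - a) \<bullet> v + R) * N / (2 * R)"
          "((x - a) \<bullet> v + R) * N / (2 * R) \<le> real (g v) + 1"
          unfolding t_def[symmetric] by linarith+
      qed
      ultimately show "x \<in> \<Union>(D ` ?G)" by blast
    qed
    moreover have "bounded (D g) \<and> diameter (D g) \<le> real (card Bs) * (2 * R) / real N" for g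
    proof
      show "bounded (D g)" by (rule bounded_subset[OF assms(1)]) (auto simp: D_def)
      show "diameter (D g) \<le> real (card Bs) * (2 * R) / real N"
      proof (rule diameter_le)
        show "D g \<noteq> {} \<or> 0 \<le> real (card Bs) * (2 * R) / real N"
          using \<open>R > 0\<close> by simp
        fix x y assume xy: "x \<in> D g" "y \<in> D g"
        \<comment> \<open>Rescaled coordinates in a common box differ by at most 1, and undoing the
          scaling turns this into the edge length \<open>2 * R / N\<close>.\<close>
        have comp: "\<bar>(x - y) \<bullet> v\<bar> \<le> 2 * R / N" if "v \<in> Bs" for v
        proof -
          have "\<bar>((x - a) \<bullet> v + R) * N / (2 * R) - ((y - a) \<bullet> v + R) * N / (2 * R)\<bar> \<le> 1"
            using xy that unfolding D_def by fastforce
          moreover have "((x - a) \<bullet> v + R) * N / (2 * R) - ((y - a) \<bullet> v + R) * N / (2 * R)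
              = ((x - y) \<bullet> v) * (N / (2 * R))"
            using \<open>R > 0\<close> by (simp add: field_simps inner_diff_left)
          ultimately have "\<bar>(x - y) \<bullet> v\<bar> * (N / (2 * R)) \<le> 1"
            using \<open>R > 0\<close> by (simp add: abs_mult)
          then show ?thesis using \<open>R > 0\<close> \<open>N > 0\<close> by (simp add: field_simps)
        qed
        have "x - y = (\<Sum>v\<in>Bs. ((x - y) \<bullet> v) *\<^sub>R v)"
          using orthonormal_basis_expand[OF Bs(1) Bs(2) _ fin] diffV xy
          by (simp add: D_def)
        then have "norm (x - y) \<le> (\<Sum>v\<in>Bs. norm (((x - y) \<bullet> v) *\<^sub>R v))"
          by (metis norm_sum)
        also have "\<dots> \<le> (\<Sum>v\<in>Bs. 2 * R / N)"
          using comp Bs(2) by (intro sum_mono) simp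
        finally show "norm (x - y) \<le> real (card Bs) * (2 * R) / real N" by simp
      qed
    qed
    ultimately show "\<exists>\<D>. finite \<D> \<and> card \<D> \<le> N ^ m \<and> A \<subseteq> \<Union>\<D> \<and>
           (\<forall>D\<in>\<D>. bounded D \<and> diameter D \<le> real (card Bs) * (2 * R) / real N)"
      by (intro exI[of _ "D ` ?G"]) (auto simp: fin finite_PiE)
  qed
qed

text \<open>At most \<open>N ^ s\<close> pieces of diameter at most \<open>C / N\<close> are used:
  the powers of \<open>N\<close> cancel in the total weight, which leaves a bound independent of the
  scale.\<close>

lemma hausdorff_outer_finite:
  fixes A :: "'a::euclidean_space set"
  assumes "bounded A" "aff_dim A \<le> int s"
  shows "hausdorff_outer s A < \<infinity>"
proof -
  obtain C where "C \<ge> 0" and C: "\<And>N::nat. N > 0 \<Longrightarrow> \<exists>\<D>. finite \<D> \<and> card \<D> \<le> N ^ s \<and> A \<subseteq> \<Union>\<D> \<and>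
           (\<forall>D\<in>\<D>. bounded D \<and> diameter D \<le> C / real N)"
    using bounded_low_dim_cover[OF assms] by metis
  let ?c = "unit_ball_vol (real s) * (C / 2) ^ s"
  have "hausdorff_outer s A \<le> ennreal ?c"
  proof (rule hausdorff_outer_le_cover)
    fix \<delta> :: real assume "\<delta> > 0"
    obtain N :: nat where N: "C / \<delta> < real N" using reals_Archimedean2 by blast
    have "N > 0" using N \<open>C \<ge> 0\<close> \<open>\<delta> > 0\<close> by (cases N) (auto simp: field_simps)
    have le: "C / real N \<le> \<delta>" using N \<open>N > 0\<close> \<open>\<delta> > 0\<close> by (simp add: field_simps)
    obtain \<D> where \<D>: "finite \<D>" "card \<D> \<le> N ^ s" "A \<subseteq> \<Union>\<D>"
        "\<forall>D\<in>\<D>. bounded D \<and> diameter D \<le> C / real N"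
      using C[OF \<open>N > 0\<close>] by blast
    have "real (card \<D>) * (unit_ball_vol (real s) * (C / real N / 2) ^ s)
        \<le> real N ^ s * (unit_ball_vol (real s) * (C / real N / 2) ^ s)"
      using \<D>(2) \<open>C \<ge> 0\<close>
      by (intro mult_right_mono) (simp_all flip: of_nat_power)
    also have "\<dots> = ?c"
      using \<open>N > 0\<close> by (simp add: power_divide)
    finally show "\<exists>\<D> r. finite \<D> \<and> A \<subseteq> \<Union>\<D> \<and> 0 \<le> r \<and> r \<le> \<delta> \<and>
      (\<forall>D\<in>\<D>. bounded D \<and> diameter D \<le> r) \<and>
      real (card \<D>) * (unit_ball_vol (real s) * (r / 2) ^ s) \<le> ?c"
      using \<D> le \<open>C \<ge> 0\<close> by (intro exI[of _ \<D>] exI[of _ "C / real N"]) auto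
  qed
  then show ?thesis by (rule le_less_trans) simp
qed

text \<open>With one dimension less there are at most \<open>N ^ m\<close> pieces, each of weight of
  order \<open>N\<close> to the power \<open>-(m + 1)\<close>, so the total is of order
  \<open>1 / N\<close>.\<close>

lemma hausdorff_outer_null:
  fixes A :: "'a::euclidean_space set"
  assumes "bounded A" "aff_dim A < int s"
  shows "hausdorff_outer s A = 0"
\<comment> \<open>The empty set has affine dimension -1 and so satisfies the hypothesis even for
  \<open>s = 0\<close>, where \<open>s\<close> is not a successor.\<close>
proof (cases "A = {}")
  case True
  have "hausdorff_outer s A \<le> ennreal 0"
    by (rule hausdorff_outer_le_cover) (use True in \<open>auto intro!: exI[of _ "{}"]\<close>)
  then show ?thesis by simp
next
  case False
  then have "\<not> aff_dim A < 0" by simp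
  then have "s > 0" using assms(2) by linarith
  then obtain m where s: "s = Suc m" using gr0_implies_Suc by blast
  obtain C where "C \<ge> 0" and C: "\<And>N::nat. N > 0 \<Longrightarrow> \<exists>\<D>. finite \<D> \<and> card \<D> \<le> N ^ m \<and> A \<subseteq> \<Union>\<D> \<and>
           (\<forall>D\<in>\<D>. bounded D \<and> diameter D \<le> C / real N)"
    using bounded_low_dim_cover[OF assms(1), of m] assms(2) s by auto
  let ?c = "unit_ball_vol (real s) * (C / 2) ^ s"
  have "?c \<ge> 0" using \<open>C \<ge> 0\<close> by simp
  have "hausdorff_outer s A \<le> ennreal \<epsilon>" if "\<epsilon> > 0" for \<epsilon>
  proof (rule hausdorff_outer_le_cover)
    fix \<delta> :: real assume "\<delta> > 0"
    \<comment> \<open>The first bound on \<open>N\<close> makes the pieces small enough for the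
      scale \<delta>, the second makes their total weight at most \<epsilon>.\<close>
    obtain N :: nat where N: "max (C / \<delta>) (?c / \<epsilon>) < real N" using reals_Archimedean2 by blast
    have "N > 0" using N \<open>C \<ge> 0\<close> \<open>\<delta> > 0\<close> by (cases N) (auto simp: field_simps)
    have le: "C / real N \<le> \<delta>" using N \<open>N > 0\<close> \<open>\<delta> > 0\<close> by (simp add: field_simps)
    obtain \<D> where \<D>: "finite \<D>" "card \<D> \<le> N ^ m" "A \<subseteq> \<Union>\<D>"
        "\<forall>D\<in>\<D>. bounded D \<and> diameter D \<le> C / real N"
      using C[OF \<open>N > 0\<close>] by blast
    have "real (card \<D>) * (unit_ball_vol (real s) * (C / real N / 2) ^ s)
        \<le> real N ^ m * (unit_ball_vol (real s) * (C / real N / 2) ^ s)"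
      using \<D>(2) \<open>C \<ge> 0\<close>
      by (intro mult_right_mono) (simp_all flip: of_nat_power)
    also have "\<dots> = ?c / real N"
      using \<open>N > 0\<close> by (simp add: power_divide s)
    also have "\<dots> \<le> \<epsilon>"
      using N \<open>N > 0\<close> that by (simp add: field_simps)
    finally show "\<exists>\<D> r. finite \<D> \<and> A \<subseteq> \<Union>\<D> \<and> 0 \<le> r \<and> r \<le> \<delta> \<and>
      (\<forall>D\<in>\<D>. bounded D \<and> diameter D \<le> r) \<and>
      real (card \<D>) * (unit_ball_vol (real s) * (r / 2) ^ s) \<le> \<epsilon>"
      using \<D> le \<open>C \<ge> 0\<close> by (intro exI[of _ \<D>] exI[of _ "C / real N"]) auto
  qed
  then have "hausdorff_outer s A \<le> 0"
    by - (rule ennreal_le_epsilon, simp)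
  then show ?thesis by simp
qed

text \<open>
  An inequality suffices here, and it holds even without the countable additivity of the Hausdorff
  outer measure: \<^const>\<open>measure_of\<close> yields the null measure if additivity fails.
\<close>

lemma emeasure_surface_le:
  fixes A :: "(real^'n) set"
  assumes "A \<in> sets borel"
  shows "emeasure surface_measure A \<le> hausdorff_outer (CARD('n) - 1) A"
proof -
  let ?M = "measure_of UNIV (sets borel) (hausdorff_outer (CARD('n) - 1)) :: (real^'n) measure"
  have "sets ?M = sets borel"
    by (metis sets.sigma_sets_eq sets_measure_of sets.space_closed space_borel)
  then have "emeasure surface_measure A = emeasure ?M A"
    using assms by (simp add: surface_measure_def)
  also have "\<dots> \<le> hausdorff_outer (CARD('n) - 1) A"
    by (simp add: emeasure_measure_of_conv)
  finally show ?thesis .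
qed

section \<open>Measurability, null sets and integrability for the surface measure\<close>

lemma space_surface_measure [simp]: "space (surface_measure :: (real^'n) measure) = UNIV"
  by (simp add: surface_measure_def space_measure_of_conv)

lemma borel_in_surface:
  assumes "A \<in> sets borel"
  shows "A \<in> sets (surface_measure :: (real^'n) measure)"
proof -
  let ?M = "measure_of UNIV (sets borel) (hausdorff_outer (CARD('n) - 1)) :: (real^'n) measure"
  have "sets ?M = sets borel"
    by (metis sets.sigma_sets_eq sets_measure_of sets.space_closed space_borel)
  then show ?thesis
    unfolding surface_measure_def using assms by (intro sets_completionI_sets) simp
qed

lemma borel_measurable_surface:
  "f \<in> borel_measurable borel \<Longrightarrow> f \<in> borel_measurable (surface_measure :: (real^'n) measure)"
  by (rule measurableI) (auto intro!: borel_in_surface measurable_sets_borel)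

lemma null_surfaceI:
  fixes A :: "(real^'n) set"
  assumes "A \<in> sets borel" "bounded A" "aff_dim A < int (CARD('n) - 1)"
  shows "A \<in> null_sets surface_measure"
proof (rule null_setsI)
  show "emeasure surface_measure A = 0"
    using emeasure_surface_le[OF assms(1)] hausdorff_outer_null[OF assms(2,3)] by simp
qed (rule borel_in_surface[OF assms(1)])

text \<open>Nothing is assumed about the values of \<open>G\<close>: in the completed measure every
  subset of \<open>N\<close> is measurable, so any function supported in \<open>N\<close> is
  measurable and vanishes almost everywhere.\<close>

lemma set_integrable_surface_null:
  fixes G :: "real^'n \<Rightarrow> real"
  assumes "N \<in> null_sets surface_measure" "A \<subseteq> N"
  shows "set_integrable surface_measure A G"
proof -
  have sub: "S \<in> sets surface_measure" if "S \<subseteq> N" for S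
    using completion.complete[OF that assms(1)[unfolded surface_measure_def]]
    by (simp add: surface_measure_def)
  let ?f = "\<lambda>x. indicator A x *\<^sub>R G x"
  have meas: "?f \<in> borel_measurable surface_measure"
  proof (rule measurableI)
    fix S :: "real set"
    show "?f -` S \<inter> space surface_measure \<in> sets surface_measure"
    proof (cases "0 \<in> S")
      case True
      \<comment> \<open>If \<open>S\<close> contains 0, the preimage contains everything outside
        \<open>N\<close>, so it is the complement that is covered by the null set.\<close>
      then have "- (?f -` S) \<subseteq> N" using assms(2) by (auto simp: indicator_def of_bool_def split: if_splits)
      then have "space surface_measure - (- (?f -` S)) \<in> sets surface_measure"
        by (intro sets.compl_sets sub)
      then show ?thesis by (simp add: Diff_eq)
    next
      case False
      then have "?f -` S \<subseteq> N" using assms(2) by (auto simp: indicator_def of_bool_def split: if_splits)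
      then show ?thesis by (simp add: sub)
    qed
  qed simp
  have "AE x in surface_measure. ?f x = 0"
    by (rule AE_I'[OF assms(1)]) (use assms(2) in \<open>auto simp: indicator_def\<close>)
  then show ?thesis
    unfolding set_integrable_def using meas integrable_cong_AE[OF meas, of "\<lambda>_. 0"] by simp
qed

text \<open>A continuous \<open>g\<close> is bounded on the compact set \<open>F\<close>, which has
  finite Hausdorff measure by its dimension. \<open>G\<close> stands for the normal trace, which is
  known only on \<open>A\<close>.\<close>

lemma set_integrable_surface_continuous:
  fixes g :: "real^'n \<Rightarrow> real"
  assumes "compact F" "aff_dim F \<le> int (CARD('n) - 1)"
    and "A \<in> sets surface_measure" "A \<subseteq> F"
    and g: "continuous_on UNIV g" and eq: "\<And>x. x \<in> A \<Longrightarrow> G x = g x"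
  shows "set_integrable surface_measure A G"
proof -
  have F: "F \<in> sets borel" using assms(1) by (simp add: borel_compact)
  obtain M where M: "\<And>x. x \<in> F \<Longrightarrow> norm (g x) \<le> M"
    using compact_imp_bounded[OF compact_continuous_image[OF continuous_on_subset[OF g] assms(1)]]
    unfolding bounded_iff by auto
  have "integrable surface_measure (\<lambda>x. indicator A x *\<^sub>R g x)"
  proof (rule integrableI_bounded_set)
    show "F \<in> sets surface_measure" using F by (rule borel_in_surface)
    show "(\<lambda>x. indicator A x *\<^sub>R g x) \<in> borel_measurable surface_measure"
      using assms(3) borel_measurable_surface[OF borel_measurable_continuous_onI[OF g]]
      by measurable
    show "emeasure surface_measure F < \<infinity>"
      using emeasure_surface_le[OF F] hausdorff_outer_finite[OF compact_imp_bounded[OF assms(1)] assms(2)]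
      by (rule le_less_trans)
    show "AE x in surface_measure. x \<in> F \<longrightarrow> norm (indicator A x *\<^sub>R g x) \<le> M"
      using M by (intro AE_I2) (auto simp: indicator_def intro: order_trans[OF abs_ge_zero])
    show "AE x in surface_measure. x \<notin> F \<longrightarrow> indicator A x *\<^sub>R g x = 0"
      using assms(4) by (intro AE_I2) (auto simp: indicator_def)
  qed
  moreover have "(\<lambda>x. indicator A x *\<^sub>R G x) = (\<lambda>x. indicator A x *\<^sub>R g x)"
    using eq by (auto simp: indicator_def)
  ultimately show ?thesis unfolding set_integrable_def by simp
qed


section \<open>Boundary geometry\<close>

text \<open>A Lipschitz domain lies on one side of its boundary: points just above the local graph
  have a neighbourhood disjoint from \<Omega>. This excludes slits, along which the closure would
  fill both sides.\<close>

lemma lipschitz_interior_closure: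
  fixes \<Omega> :: "(real^'n) set"
  assumes "open \<Omega>" "lipschitz_boundary \<Omega>"
  shows "interior (closure \<Omega>) \<subseteq> \<Omega>"
proof (rule ccontr)
  assume "\<not> ?thesis"
  then obtain x where x: "x \<in> interior (closure \<Omega>)" "x \<notin> \<Omega>" by blast
  then have "x \<in> frontier \<Omega>"
    using interior_subset interior_open[OF assms(1)] by (fastforce simp: frontier_def)
  then obtain U \<nu> L and \<phi> :: "real^'n \<Rightarrow> real"
    where U: "open U" "x \<in> U" and \<nu>: "norm \<nu> = 1" and L: "L-lipschitz_on {z. z \<bullet> \<nu> = 0} \<phi>"
      and \<Omega>: "\<Omega> \<inter> U = {y\<in>U. y \<bullet> \<nu> < \<phi> (y - (y \<bullet> \<nu>) *\<^sub>R \<nu>)}"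
    using assms(2)[unfolded lipschitz_boundary_def, rule_format, of x] by blast
  \<comment> \<open>The height of the graph, extended to the whole space as a function constant
    along \<nu>. The projection maps into the hyperplane on which \<phi> is continuous.\<close>
  define \<psi> where "\<psi> y = \<phi> (y - (y \<bullet> \<nu>) *\<^sub>R \<nu>)" for y
  have \<nu>\<nu>: "\<nu> \<bullet> \<nu> = 1" using \<nu> by (simp add: norm_eq_1)
  have "continuous_on UNIV (\<phi> \<circ> (\<lambda>y. y - (y \<bullet> \<nu>) *\<^sub>R \<nu>))"
  proof (rule continuous_on_compose)
    show "continuous_on (range (\<lambda>y. y - (y \<bullet> \<nu>) *\<^sub>R \<nu>)) \<phi>"
      by (rule continuous_on_subset[OF lipschitz_on_continuous_on[OF L]])
        (auto simp: inner_diff_left \<nu>\<nu>)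
  qed (intro continuous_intros)
  then have cont: "continuous_on UNIV \<psi>" by (simp add: \<psi>_def o_def)
  define W where "W = U \<inter> {y. \<psi> y < y \<bullet> \<nu>}"
  have "open W"
    unfolding W_def by (intro open_Int U open_Collect_less cont continuous_intros)
  have "W \<inter> (\<Omega> \<inter> U) = {}" unfolding \<Omega> by (auto simp: W_def \<psi>_def)
  then have "W \<inter> \<Omega> = {}" by (auto simp: W_def)
  then have disj: "W \<inter> closure \<Omega> = {}"
    using open_Int_closure_eq_empty[OF \<open>open W\<close>] by blast
  have "open (interior (closure \<Omega>) \<inter> U)" using U(1) by blast
  then obtain e where e: "e > 0" "ball x e \<subseteq> interior (closure \<Omega>) \<inter> U"
    using x(1) U(2) by (meson IntI open_contains_ball)
  \<comment> \<open>As \<open>x\<close> is outside \<Omega>, it lies on or above the graph; a small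
    move along \<nu> makes this strict without leaving the ball.\<close>
  define y where "y = x + (e / 2) *\<^sub>R \<nu>"
  have "y \<in> ball x e" using e(1) \<nu> by (simp add: y_def dist_norm)
  then have "y \<in> U" "y \<in> closure \<Omega>" using e(2) interior_subset by blast+
  have "\<psi> y = \<psi> x" by (simp add: \<psi>_def y_def inner_add_left \<nu>\<nu> algebra_simps)
  moreover have "\<psi> x \<le> x \<bullet> \<nu>" using \<Omega> x(2) U(2) unfolding \<psi>_def by fastforce
  moreover have "y \<bullet> \<nu> = x \<bullet> \<nu> + e / 2" by (simp add: y_def inner_add_left \<nu>\<nu>)
  ultimately have "y \<in> W" using \<open>y \<in> U\<close> e(1) by (simp add: W_def)
  then show False using disj \<open>y \<in> closure \<Omega>\<close> by blast
qed

text \<open>If two unit normals \<open>a\<close> and \<nu> differed, a short move from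
  \<open>x\<close> along \<open>a - \<nu>\<close> would leave \<Omega> according to \<open>a\<close>
  and enter it according to \<nu>.\<close>

lemma outward_normal_eq:
  assumes "is_outward_unit_normal \<Omega> x a"
  shows "outward_normal \<Omega> x = a"
  unfolding outward_normal_def
proof (rule the_equality)
  show "is_outward_unit_normal \<Omega> x a" by (rule assms)
  fix \<nu> assume \<nu>: "is_outward_unit_normal \<Omega> x \<nu>"
  show "\<nu> = a"
  proof (rule ccontr)
    assume "\<nu> \<noteq> a"
    have n: "\<nu> \<bullet> \<nu> = 1" "a \<bullet> a = 1"
      using assms \<nu> by (auto simp: is_outward_unit_normal_def norm_eq_1)
    define u where "u = a - \<nu>"
    define d where "d = u \<bullet> u / 2"
    have "d > 0" using \<open>\<nu> \<noteq> a\<close> by (simp add: d_def u_def)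
    have "u \<bullet> a = d" "u \<bullet> \<nu> = - d"
      using n by (simp_all add: u_def d_def inner_diff_left inner_diff_right inner_commute field_simps)
    \<comment> \<open>This aperture gives \<open>e * norm u = d / 2\<close>, so the direction
      \<open>u\<close> lies in the outer cone of \<open>a\<close> and in the inner cone of
      \<nu>.\<close>
    define e where "e = d / (2 * norm u)"
    have "norm u > 0" using \<open>\<nu> \<noteq> a\<close> by (simp add: u_def)
    then have "e > 0" "e * norm u < d" using \<open>d > 0\<close> by (simp_all add: e_def)
    obtain r1 where r1: "r1 > 0" "\<And>y. y \<in> ball x r1 \<Longrightarrow> (y - x) \<bullet> a > e * norm (y - x) \<Longrightarrow> y \<notin> \<Omega>"
      using assms \<open>e > 0\<close> unfolding is_outward_unit_normal_def by meson
    obtain r2 where r2: "r2 > 0" "\<And>y. y \<in> ball x r2 \<Longrightarrow> (y - x) \<bullet> \<nu> < - e * norm (y - x) \<Longrightarrow> y \<in> \<Omega>"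
      using \<nu> \<open>e > 0\<close> unfolding is_outward_unit_normal_def by meson
    define t where "t = min r1 r2 / (2 * norm u)"
    have t: "t > 0" "t * norm u < r1" "t * norm u < r2"
      using r1(1) r2(1) \<open>norm u > 0\<close> by (auto simp: t_def)
    define y where "y = x + t *\<^sub>R u"
    have "y \<in> ball x r1" "y \<in> ball x r2" using t by (simp_all add: y_def dist_norm)
    moreover have "(y - x) \<bullet> a > e * norm (y - x)" "(y - x) \<bullet> \<nu> < - e * norm (y - x)"
      using \<open>u \<bullet> a = d\<close> \<open>u \<bullet> \<nu> = - d\<close> t(1) \<open>e * norm u < d\<close>
        mult_strict_left_mono[OF \<open>e * norm u < d\<close> t(1)]
      by (simp_all add: y_def mult.left_commute)
    ultimately show False using r1(2) r2(2) by blast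
  qed
qed

section \<open>Convex cells near a facet\<close>

text \<open>By convexity \<open>K\<close> contains the join of \<open>z\<close> with a relative
  neighbourhood of \<open>x\<close> in the hyperplane, and this join is a one-sided neighbourhood of
  \<open>x\<close>.\<close>

lemma convex_contains_half_ball:
  fixes K :: "'a::euclidean_space set"
  assumes "convex K" "f \<subseteq> K" and hull: "affine hull f = {y. a \<bullet> y = \<beta>}"
    and x: "x \<in> rel_interior f" and z: "z \<in> K" "a \<bullet> z < \<beta>"
  shows "\<exists>r>0. \<forall>y\<in>ball x r. a \<bullet> y \<le> \<beta> \<longrightarrow> y \<in> K"
proof -
  obtain e where e: "e > 0" "cball x e \<inter> affine hull f \<subseteq> f"
    using x by (auto simp: mem_rel_interior_cball)
  have "x \<in> f" using x rel_interior_subset by blast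
  then have ax: "a \<bullet> x = \<beta>" using hull hull_inc by fastforce
  text \<open>Each \<open>y\<close> below the hyperplane near \<open>x\<close> lies on the segment from \<open>z\<close> to \<open>p y\<close> in the hyperplane.\<close>
  define t where "t y = (\<beta> - a \<bullet> y) / (\<beta> - a \<bullet> z)" for y
  define p where "p y = (1 / (1 - t y)) *\<^sub>R (y - t y *\<^sub>R z)" for y
  have tx: "t x = 0" and px: "p x = x" using ax by (simp_all add: t_def p_def)
  have ct: "(t \<longlongrightarrow> t x) (at x)" unfolding t_def using z(2) by (intro tendsto_intros) auto
  have "(p \<longlongrightarrow> p x) (at x)"
    unfolding p_def using tx by (intro tendsto_intros ct) auto
  then have "eventually (\<lambda>y. dist (p y) (p x) < e) (at x)" using e(1) by (rule tendstoD)
  moreover have "eventually (\<lambda>y. t y < 1) (at x)"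
    using ct tx by (intro order_tendstoD) auto
  ultimately have "eventually (\<lambda>y. dist (p y) x < e \<and> t y < 1) (at x)"
    using px by (simp add: eventually_conj)
  then obtain r where r: "r > 0" "\<And>y. y \<noteq> x \<Longrightarrow> dist y x < r \<Longrightarrow> dist (p y) x < e \<and> t y < 1"
    unfolding eventually_at by auto
  show ?thesis
  proof (intro exI[of _ r] conjI r(1) ballI impI)
    fix y assume y: "y \<in> ball x r" "a \<bullet> y \<le> \<beta>"
    \<comment> \<open>The limits concern only \<open>y\<close> different from \<open>x\<close>; at
      \<open>x\<close> itself the values \<open>p x = x\<close> and \<open>t x = 0\<close>
      serve.\<close>
    have near: "dist (p y) x < e \<and> t y < 1"
      using r(2)[of y] y(1) px tx e(1) by (cases "y = x") (auto simp: dist_commute)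
    have "t y \<ge> 0" using y(2) z(2) by (simp add: t_def)
    have "t y * (\<beta> - a \<bullet> z) = \<beta> - a \<bullet> y" using z(2) by (simp add: t_def)
    then have "a \<bullet> y - t y * (a \<bullet> z) = (1 - t y) * \<beta>" by (simp add: algebra_simps)
    then have "a \<bullet> p y = \<beta>" using near by (simp add: p_def inner_diff_right)
    then have "p y \<in> f" using e(2) hull near by (auto simp: dist_commute)
    then have "p y \<in> K" using assms(2) by blast
    have "(1 - t y) *\<^sub>R p y + t y *\<^sub>R z \<in> K"
      using assms(1) \<open>p y \<in> K\<close> z(1) near \<open>t y \<ge> 0\<close> by (intro convexD) auto
    also have "(1 - t y) *\<^sub>R p y + t y *\<^sub>R z = y" using near by (simp add: p_def)
    finally show "y \<in> K" .
  qed
qed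

lemma exists_off_hyperplane:
  fixes K :: "'a::euclidean_space set"
  assumes "interior K \<noteq> {}" "a \<noteq> 0"
  shows "\<exists>z\<in>K. a \<bullet> z \<noteq> \<beta>"
proof (rule ccontr)
  assume "\<not> ?thesis"
  then have "K \<subseteq> {z. a \<bullet> z = \<beta>}" by blast
  then have "interior K \<subseteq> interior {z. a \<bullet> z = \<beta>}" by (rule interior_mono)
  then show False using assms by simp
qed

text \<open>The supporting hyperplane contains the affine hull of the facet, and their dimensions
  agree because \<open>K\<close> is full-dimensional. Rescaling its equation makes the normal a unit
  vector.\<close>

lemma facet_hyperplane:
  fixes K :: "'a::euclidean_space set"
  assumes "polytope K" "interior K \<noteq> {}" "f facet_of K"
  obtains a \<beta> where "norm a = 1" "affine hull f = {y. a \<bullet> y = \<beta>}" "K \<subseteq> {y. a \<bullet> y \<le> \<beta>}"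
proof -
  obtain c \<gamma> where c: "c \<noteq> 0" "K \<subseteq> {y. c \<bullet> y \<le> \<gamma>}" "f = K \<inter> {y. c \<bullet> y = \<gamma>}"
    using facet_of_polyhedron[OF polytope_imp_polyhedron[OF assms(1)] assms(3)] by metis
  have "f \<noteq> {}" using assms(3) by (simp add: facet_of_def)
  have "affine hull f = {y. c \<bullet> y = \<gamma>}"
  proof (rule affine_dim_equal)
    show "affine hull f \<subseteq> {y. c \<bullet> y = \<gamma>}"
      using c(3) by (intro hull_minimal affine_hyperplane) auto
    show "aff_dim (affine hull f) = aff_dim {y. c \<bullet> y = \<gamma>}"
      using assms(3) c(1) aff_dim_nonempty_interior[OF assms(2)] by (simp add: facet_of_def)
  qed (use \<open>f \<noteq> {}\<close> affine_hyperplane in auto)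
  moreover have "(c /\<^sub>R norm c) \<bullet> y \<le> \<gamma> / norm c \<longleftrightarrow> c \<bullet> y \<le> \<gamma>"
    "(c /\<^sub>R norm c) \<bullet> y = \<gamma> / norm c \<longleftrightarrow> c \<bullet> y = \<gamma>" for y
    using c(1) by (simp_all add: field_simps)
  ultimately show ?thesis
    using c(1,2) by (intro that[of "c /\<^sub>R norm c" "\<gamma> / norm c"]) auto
qed

section \<open>Traces on the boundary facets of a mesh\<close>

text \<open>Abstracts from the two cell types and from the Lipschitz charts: cells are
  full-dimensional polytopes, and \<open>interior_closure\<close> records that the domain has no
  slits.\<close>

locale polytopal_mesh =
  fixes \<Omega> :: "(real^'n) set" and T :: "(real^'n) set set"
  assumes open_domain: "open \<Omega>"
    and interior_closure: "interior (closure \<Omega>) \<subseteq> \<Omega>"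
    and finite_cells: "finite T"
    and Union_cells: "\<Union>T = closure \<Omega>"
    and polytope_cell: "K \<in> T \<Longrightarrow> polytope K"
    and interior_cell: "K \<in> T \<Longrightarrow> interior K \<noteq> {}"
    and conforming: "K \<in> T \<Longrightarrow> K' \<in> T \<Longrightarrow> K \<inter> K' face_of K \<and> K \<inter> K' face_of K'"
begin

text \<open>A proper face misses the interior of its cell, so a common face through a point interior
  to both cells is the whole of each.\<close>

lemma cells_eq_if_interiors_meet:
  assumes "K \<in> T" "K' \<in> T" "interior K \<inter> interior K' \<noteq> {}"
  shows "K' = K"
proof -
  have "K \<inter> K' = K"
    using assms conforming[of K K'] interior_subset[of K] interior_subset[of K']
      face_of_disjoint_interior[of "K \<inter> K'" K] by blast
  moreover have "K \<inter> K' = K'"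
    using assms conforming[of K K'] interior_subset[of K] interior_subset[of K']
      face_of_disjoint_interior[of "K \<inter> K'" K'] by blast
  ultimately show ?thesis by simp
qed

text \<open>By conformity a second cell through \<open>x\<close> would contain all of
  \<open>f\<close>. On the same side of the hyperplane of \<open>f\<close> the two cells would share
  interior points; on opposite sides they would fill a ball, which puts \<open>x\<close> inside
  \<Omega>.\<close>

lemma boundary_cell_unique:
  assumes K: "K \<in> T" "K' \<in> T" and f: "f facet_of K"
    and x: "x \<in> frontier \<Omega>" "x \<in> rel_interior f" "x \<in> K'"
  shows "K' = K"
proof (rule ccontr)
  assume ne: "K' \<noteq> K"
  obtain a \<beta> where a: "norm a = 1" "affine hull f = {y. a \<bullet> y = \<beta>}" "K \<subseteq> {y. a \<bullet> y \<le> \<beta>}"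
    using facet_hyperplane[OF polytope_cell[OF K(1)] interior_cell[OF K(1)] f] by metis
  have "a \<noteq> 0" using a(1) by auto
  have "f \<subseteq> K" using f by (rule facet_of_imp_subset)
  moreover have "x \<in> K \<inter> K'" using x \<open>f \<subseteq> K\<close> rel_interior_subset by blast
  \<comment> \<open>A face that meets the relative interior of a subset of \<open>K\<close> contains
    that subset.\<close>
  ultimately have "f \<subseteq> K \<inter> K'"
    using subset_of_face_of[of "K \<inter> K'" K f] conforming[OF K] x(2) by blast
  then have "f \<subseteq> K'" by blast
  obtain z where z: "z \<in> K" "a \<bullet> z < \<beta>"
    using exists_off_hyperplane[OF interior_cell[OF K(1)] \<open>a \<noteq> 0\<close>, of \<beta>] a(3) by force
  obtain r where r: "r > 0" "\<And>y. y \<in> ball x r \<Longrightarrow> a \<bullet> y \<le> \<beta> \<Longrightarrow> y \<in> K"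
    using convex_contains_half_ball[OF polytope_imp_convex[OF polytope_cell[OF K(1)]]
        \<open>f \<subseteq> K\<close> a(2) x(2) z] by blast
  obtain z' where z': "z' \<in> K'" "a \<bullet> z' \<noteq> \<beta>"
    using exists_off_hyperplane[OF interior_cell[OF K(2)] \<open>a \<noteq> 0\<close>, of \<beta>] by blast
  have xf: "x \<in> f" using x(2) rel_interior_subset by blast
  then have ax: "a \<bullet> x = \<beta>" using a(2) hull_inc by fastforce
  note half = convex_contains_half_ball[OF polytope_imp_convex[OF polytope_cell[OF K(2)]]
      \<open>f \<subseteq> K'\<close> _ x(2) z'(1)]
  show False
  proof (cases "a \<bullet> z' < \<beta>")
    case True
    then obtain r' where r': "r' > 0" "\<And>y. y \<in> ball x r' \<Longrightarrow> a \<bullet> y \<le> \<beta> \<Longrightarrow> y \<in> K'"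
      using half[OF a(2)] by blast
    define W where "W = ball x (min r r') \<inter> {y. a \<bullet> y < \<beta>}"
    have "open W" unfolding W_def by (intro open_Int open_ball open_halfspace_lt)
    moreover have "W \<subseteq> K" "W \<subseteq> K'" using r(2) r'(2) by (auto simp: W_def)
    ultimately have "W \<subseteq> interior K \<inter> interior K'" by (simp add: interior_maximal)
    moreover have "x - (min r r' / 2) *\<^sub>R a \<in> W"
    proof -
      have "a \<bullet> a = 1" using a(1) by (simp add: norm_eq_1)
      then show ?thesis
        using r(1) r'(1) a(1) ax by (auto simp: W_def dist_norm inner_diff_right)
    qed
    ultimately show False using cells_eq_if_interiors_meet[OF K] ne by blast
  next
    case False
    \<comment> \<open>Reversing the signs of \<open>a\<close> and \<beta> lets the half-ball lemma
      apply to \<open>K'\<close> on the far side of the hyperplane.\<close>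
    then have "(- a) \<bullet> z' < - \<beta>" using z'(2) by simp
    moreover have "affine hull f = {y. (- a) \<bullet> y = - \<beta>}" using a(2) by simp
    ultimately obtain r' where r': "r' > 0" "\<And>y. y \<in> ball x r' \<Longrightarrow> (- a) \<bullet> y \<le> - \<beta> \<Longrightarrow> y \<in> K'"
      using half by blast
    have "ball x (min r r') \<subseteq> closure \<Omega>"
    proof
      fix y assume "y \<in> ball x (min r r')"
      then have "y \<in> K \<union> K'" using r(2)[of y] r'(2)[of y] by fastforce
      then show "y \<in> closure \<Omega>" using Union_cells K by blast
    qed
    then have "x \<in> interior (closure \<Omega>)"
      using r(1) r'(1) by (meson min_less_iff_conj mem_interior)
    then show False
      using interior_closure x(1) interior_open[OF open_domain] by (auto simp: frontier_def)
  qed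
qed

text \<open>The other cells form a closed set that misses \<open>x\<close>, so near \<open>x\<close>
  the domain is covered by \<open>K\<close> alone, and \<open>K\<close> contains a half-ball. The
  vector \<open>a\<close> is chosen before \<open>x\<close>, which makes the normal constant along
  the facet.\<close>

lemma facet_local_half_space:
  assumes K: "K \<in> T" and f: "f facet_of K"
  obtains a \<beta> where "norm a = 1" and "\<And>y. y \<in> f \<Longrightarrow> a \<bullet> y = \<beta>"
    and "\<And>x. x \<in> frontier \<Omega> \<Longrightarrow> x \<in> rel_interior f \<Longrightarrow>
      \<exists>r>0. \<forall>y\<in>ball x r. (y \<in> \<Omega> \<longleftrightarrow> a \<bullet> y < \<beta>) \<and> (y \<in> \<Omega> \<longrightarrow> y \<in> interior K)"
proof -
  obtain a \<beta> where a: "norm a = 1" "affine hull f = {y. a \<bullet> y = \<beta>}" "K \<subseteq> {y. a \<bullet> y \<le> \<beta>}"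
    using facet_hyperplane[OF polytope_cell[OF K] interior_cell[OF K] f] by metis
  have "a \<noteq> 0" using a(1) by auto
  have "f \<subseteq> K" using f by (rule facet_of_imp_subset)
  obtain z where z: "z \<in> K" "a \<bullet> z < \<beta>"
    using exists_off_hyperplane[OF interior_cell[OF K] \<open>a \<noteq> 0\<close>, of \<beta>] a(3) by force
  have "\<exists>r>0. \<forall>y\<in>ball x r. (y \<in> \<Omega> \<longleftrightarrow> a \<bullet> y < \<beta>) \<and> (y \<in> \<Omega> \<longrightarrow> y \<in> interior K)"
    if x: "x \<in> frontier \<Omega>" "x \<in> rel_interior f" for x
  proof -
    obtain r1 where r1: "r1 > 0" "\<And>y. y \<in> ball x r1 \<Longrightarrow> a \<bullet> y \<le> \<beta> \<Longrightarrow> y \<in> K"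
      using convex_contains_half_ball[OF polytope_imp_convex[OF polytope_cell[OF K]]
          \<open>f \<subseteq> K\<close> a(2) x(2) z] by blast
    have "closed (\<Union>(T - {K}))"
      using finite_cells polytope_cell by (intro closed_Union) (auto intro: polytope_imp_closed)
    moreover have "x \<notin> \<Union>(T - {K})" using boundary_cell_unique[OF K _ f x] by blast
    ultimately obtain r2 where r2: "r2 > 0" "ball x r2 \<subseteq> - \<Union>(T - {K})"
      by (meson ComplI open_Compl open_contains_ball)
    define r where "r = min r1 r2"
    have "ball x r \<inter> \<Omega> \<subseteq> K"
    proof
      fix y assume "y \<in> ball x r \<inter> \<Omega>"
      then have "y \<in> \<Union>T" "y \<notin> \<Union>(T - {K})"
        using closure_subset[of \<Omega>] Union_cells r2(2) by (auto simp: r_def)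
      then show "y \<in> K" by blast
    qed
    then have int: "ball x r \<inter> \<Omega> \<subseteq> interior K"
      by (intro interior_maximal open_Int open_ball open_domain)
    moreover have "interior K \<subseteq> {y. a \<bullet> y < \<beta>}"
      using interior_mono[OF a(3)] \<open>a \<noteq> 0\<close> by simp
    moreover have "ball x r \<inter> {y. a \<bullet> y < \<beta>} \<subseteq> \<Omega>"
    proof -
      have "ball x r \<inter> {y. a \<bullet> y < \<beta>} \<subseteq> closure \<Omega>"
        using r1(2) K Union_cells by (fastforce simp: r_def)
      then have "ball x r \<inter> {y. a \<bullet> y < \<beta>} \<subseteq> interior (closure \<Omega>)"
        by (intro interior_maximal open_Int open_ball open_halfspace_lt)
      then show ?thesis using interior_closure by blast
    qed
    ultimately have "\<forall>y\<in>ball x r. (y \<in> \<Omega> \<longleftrightarrow> a \<bullet> y < \<beta>) \<and> (y \<in> \<Omega> \<longrightarrow> y \<in> interior K)"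
      by blast
    moreover have "r > 0" using r1(1) r2(1) by (simp add: r_def)
    ultimately show ?thesis by blast
  qed
  moreover have "a \<bullet> y = \<beta>" if "y \<in> f" for y
    using a(2) hull_inc[OF that, of affine] by auto
  ultimately show ?thesis using that a(1) by blast
qed

text \<open>Near \<open>x\<close> the domain is a half-space inside \<open>interior K\<close>, where
  \<open>v\<close> equals the continuous \<open>w\<close>. The limit in the trace is therefore
  \<open>w x\<close>, and one vector \<open>a\<close> serves for the whole facet.\<close>

lemma normal_trace_on_facet:
  assumes K: "K \<in> T" and f: "f facet_of K"
    and w: "continuous_on UNIV w" "\<And>x. x \<in> interior K \<Longrightarrow> v x = w x"
  obtains a where "\<And>x. x \<in> frontier \<Omega> \<Longrightarrow> x \<in> rel_interior f \<Longrightarrow> normal_trace \<Omega> v x = w x \<bullet> a"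
proof -
  obtain a \<beta> where a: "norm a = 1" "\<And>y. y \<in> f \<Longrightarrow> a \<bullet> y = \<beta>"
    and loc: "\<And>x. x \<in> frontier \<Omega> \<Longrightarrow> x \<in> rel_interior f \<Longrightarrow>
      \<exists>r>0. \<forall>y\<in>ball x r. (y \<in> \<Omega> \<longleftrightarrow> a \<bullet> y < \<beta>) \<and> (y \<in> \<Omega> \<longrightarrow> y \<in> interior K)"
    using facet_local_half_space[OF K f] by blast
  show ?thesis
  proof (rule that)
    fix x assume x: "x \<in> frontier \<Omega>" "x \<in> rel_interior f"
    obtain r where r: "r > 0"
        "\<And>y. y \<in> ball x r \<Longrightarrow> (y \<in> \<Omega> \<longleftrightarrow> a \<bullet> y < \<beta>) \<and> (y \<in> \<Omega> \<longrightarrow> y \<in> interior K)"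
      using loc[OF x] by blast
    have ax: "a \<bullet> x = \<beta>" using a(2) x(2) rel_interior_subset by blast
    have "is_outward_unit_normal \<Omega> x a"
      unfolding is_outward_unit_normal_def
    proof (intro conjI allI impI)
      fix e :: real assume "e > 0"
      \<comment> \<open>The domain is exactly a half-space in the ball, so the same radius
        \<open>r\<close> works for every \<open>e\<close>.\<close>
      have "(y - x) \<bullet> a = a \<bullet> y - \<beta>" for y
        using ax inner_diff_right[of a y x] by (simp add: inner_commute)
      moreover have "0 \<le> e * norm (y - x)" for y using \<open>e > 0\<close> by simp
      ultimately have "\<forall>y\<in>ball x r. ((y - x) \<bullet> a < - e * norm (y - x) \<longrightarrow> y \<in> \<Omega>) \<and>
          ((y - x) \<bullet> a > e * norm (y - x) \<longrightarrow> y \<notin> \<Omega>)"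
        using r(2) by (smt (verit) mult_minus_left)
      then show "\<exists>r>0. \<forall>y\<in>ball x r. ((y - x) \<bullet> a < - e * norm (y - x) \<longrightarrow> y \<in> \<Omega>) \<and>
          ((y - x) \<bullet> a > e * norm (y - x) \<longrightarrow> y \<notin> \<Omega>)" using r(1) by blast
    qed (rule a(1))
    then have nu: "outward_normal \<Omega> x = a" by (rule outward_normal_eq)
    have xc: "x \<in> closure \<Omega>" "x \<notin> \<Omega>"
      using x(1) interior_open[OF open_domain] by (auto simp: frontier_def)
    \<comment> \<open>\<open>x\<close> is a limit point of \<Omega>; without this the limit along
      \<Omega> would not be unique and \<open>Lim\<close> would not be determined.\<close>
    then have nt: "at x within \<Omega> \<noteq> bot"
      by (metis closure_def Un_iff islimpt_def mem_Collect_eq trivial_limit_within)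
    have "(w \<longlongrightarrow> w x) (at x within \<Omega>)"
      using w(1) by (metis UNIV_I continuous_on_def tendsto_within_subset top_greatest)
    moreover have "eventually (\<lambda>y. w y = v y) (at x within \<Omega>)"
      unfolding eventually_at
      using r w(2) by (intro exI[of _ r]) (auto simp: dist_commute)
    ultimately have "(v \<longlongrightarrow> w x) (at x within \<Omega>)" by (rule Lim_transform_eventually)
    then have "Lim (at x within \<Omega>) v = w x" using nt by (intro tendsto_Lim)
    then show "normal_trace \<Omega> v x = w x \<bullet> a" by (simp add: normal_trace_def nu)
  qed
qed

section \<open>Facets of the cells: finiteness, dimension, null frontiers, covering of the
  boundary\<close>

definition facets :: "(real^'n) set set" where
  "facets = {f. \<exists>K\<in>T. f facet_of K}"

lemma finite_facets: "finite facets"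
proof -
  have "facets = (\<Union>K\<in>T. {f. f facet_of K})" by (auto simp: facets_def)
  then show ?thesis using finite_cells polytope_cell finite_polytope_facets by auto
qed

lemma polytope_facet: "f \<in> facets \<Longrightarrow> polytope f"
  unfolding facets_def using polytope_cell face_of_polytope_polytope facet_of_imp_face_of by blast

lemma aff_dim_facet:
  assumes "f \<in> facets"
  shows "aff_dim f = int (CARD('n) - 1)"
proof -
  obtain K where K: "K \<in> T" "f facet_of K" using assms by (auto simp: facets_def)
  have "aff_dim K = int CARD('n)" using aff_dim_nonempty_interior[OF interior_cell[OF K(1)]] by simp
  then show ?thesis using K(2) by (simp add: facet_of_def of_nat_diff Suc_leI)
qed

text \<open>The relative frontier is the finite union of the facets of \<open>f\<close>, whose
  dimension is one below that of the surface measure.\<close>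

lemma rel_frontier_facet_null:
  assumes "f \<in> facets"
  shows "rel_frontier f \<in> null_sets surface_measure"
proof -
  have "rel_frontier f = (\<Union>e\<in>{e. e facet_of f}. e)"
    using rel_frontier_of_polyhedron[OF polytope_imp_polyhedron[OF polytope_facet[OF assms]]] by simp
  also have "\<dots> \<in> null_sets surface_measure"
  proof (rule null_sets.finite_UN)
    show "finite {e. e facet_of f}" using polytope_facet[OF assms] by (rule finite_polytope_facets)
    fix e assume e: "e \<in> {e. e facet_of f}"
    then have "polytope e"
      using polytope_facet[OF assms] face_of_polytope_polytope facet_of_imp_face_of by blast
    then show "e \<in> null_sets surface_measure"
      using e aff_dim_facet[OF assms]
      by (intro null_surfaceI) (auto simp: facet_of_def polytope_imp_closed polytope_imp_bounded)
  qed
  finally show ?thesis .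
qed

lemma rel_interior_facet_sets:
  assumes "f \<in> facets"
  shows "f \<in> sets surface_measure" "rel_interior f \<in> sets surface_measure"
    and "rel_interior f = f - rel_frontier f"
proof -
  have cl: "closed f" using polytope_facet[OF assms] by (rule polytope_imp_closed)
  then show f: "f \<in> sets surface_measure" by (intro borel_in_surface) auto
  show *: "rel_interior f = f - rel_frontier f"
    using cl rel_interior_subset[of f] by (auto simp: rel_frontier_def)
  show "rel_interior f \<in> sets surface_measure"
    unfolding * using f rel_frontier_facet_null[OF assms] by auto
qed

text \<open>Cell interiors lie in \<Omega>, so a boundary point is in the relative frontier of any
  cell containing it, and this is the union of the facets of that cell.\<close>

lemma frontier_covered: "frontier \<Omega> \<subseteq> \<Union>facets"
proof
  fix x assume x: "x \<in> frontier \<Omega>"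
  then have "x \<in> closure \<Omega>" "x \<notin> \<Omega>"
    using interior_open[OF open_domain] by (auto simp: frontier_def)
  then obtain K where K: "K \<in> T" "x \<in> K" using Union_cells by blast
  have "interior K \<subseteq> \<Omega>"
    using interior_mono[of K "closure \<Omega>"] K(1) Union_cells interior_closure by blast
  then have "x \<in> rel_frontier K"
    using \<open>x \<notin> \<Omega>\<close> K(2) interior_cell[OF K(1)] closure_subset
    by (auto simp: rel_frontier_def rel_interior_nonempty_interior)
  then show "x \<in> \<Union>facets"
    using K(1) rel_frontier_of_polyhedron[OF polytope_imp_polyhedron[OF polytope_cell[OF K(1)]]]
    by (auto simp: facets_def)
qed

text \<open>Only one cell contains \<open>x\<close>, so both facets belong to it, and distinct faces
  of a convex set have disjoint relative interiors.\<close>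

lemma boundary_facets_eq:
  assumes "f \<in> facets" "f' \<in> facets"
    and x: "x \<in> frontier \<Omega>" "x \<in> rel_interior f" "x \<in> rel_interior f'"
  shows "f' = f"
proof -
  obtain K K' where K: "K \<in> T" "f facet_of K" "K' \<in> T" "f' facet_of K'"
    using assms(1,2) by (auto simp: facets_def)
  have "x \<in> K'" using x(3) rel_interior_subset facet_of_imp_subset[OF K(4)] by blast
  then have "K' = K" using boundary_cell_unique[OF K(1,3,2) x(1,2)] by blast
  then show ?thesis
    using K x(2,3) by (intro face_of_eq[of _ K]) (auto intro: facet_of_imp_face_of)
qed

section \<open>Integrals of the squared normal trace\<close>

context
  fixes v :: "real^'n \<Rightarrow> real^'n"
  assumes piecewise: "\<And>K. K \<in> T \<Longrightarrow> \<exists>w. continuous_on UNIV w \<and> (\<forall>x\<in>interior K. v x = w x)"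
begin

text \<open>The facet is split into its relative interior, where the trace is a continuous function,
  and its null relative frontier. Intersecting with \<open>D\<close> admits facets that meet the
  boundary only in part.\<close>

lemma trace_integrable_on_facet:
  assumes f: "f \<in> facets" and D: "D \<in> sets surface_measure" "D \<subseteq> frontier \<Omega>"
  shows "set_integrable surface_measure (D \<inter> f) (\<lambda>x. normal_trace \<Omega> v x * normal_trace \<Omega> v x)"
    (is "set_integrable _ _ ?G")
proof -
  obtain K where K: "K \<in> T" "f facet_of K" using f by (auto simp: facets_def)
  obtain w where w: "continuous_on UNIV w" "\<And>x. x \<in> interior K \<Longrightarrow> v x = w x"
    using piecewise[OF K(1)] by blast
  obtain a where a: "\<And>x. x \<in> frontier \<Omega> \<Longrightarrow> x \<in> rel_interior f \<Longrightarrow> normal_trace \<Omega> v x = w x \<bullet> a"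
    using normal_trace_on_facet[OF K w] by blast
  have "set_integrable surface_measure (D \<inter> rel_interior f) ?G"
  proof (rule set_integrable_surface_continuous)
    show "compact f" using polytope_facet[OF f] by (rule polytope_imp_compact)
    show "aff_dim f \<le> int (CARD('n) - 1)" using aff_dim_facet[OF f] by simp
    show "D \<inter> rel_interior f \<in> sets surface_measure" using D(1) rel_interior_facet_sets[OF f] by auto
    show "D \<inter> rel_interior f \<subseteq> f" using rel_interior_subset by blast
    show "continuous_on UNIV (\<lambda>x. (w x \<bullet> a) * (w x \<bullet> a))" by (intro continuous_intros w)
    show "?G x = (w x \<bullet> a) * (w x \<bullet> a)" if "x \<in> D \<inter> rel_interior f" for x
      using a[of x] that D(2) by auto
  qed
  moreover have "set_integrable surface_measure (D \<inter> rel_frontier f) ?G"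
    using rel_frontier_facet_null[OF f] by (rule set_integrable_surface_null) auto
  moreover have "D \<inter> f = D \<inter> rel_interior f \<union> D \<inter> rel_frontier f"
    using rel_interior_facet_sets(3)[OF f] polytope_imp_closed[OF polytope_facet[OF f]]
    by (auto simp: rel_frontier_def)
  ultimately show ?thesis
    using D(1) rel_interior_facet_sets[OF f] rel_frontier_facet_null[OF f]
    by (auto intro!: set_integrable_Un)
qed

text \<open>Passing to relative interiors discards null sets only; it makes the facets disjoint and
  places them inside \<Gamma>. The sum is then the integral of a nonnegative function over a subset
  of \<Gamma>.\<close>

lemma sum_facet_traces_le:
  assumes \<Gamma>: "\<Gamma> \<in> sets surface_measure" "\<Gamma> \<subseteq> frontier \<Omega>"
  shows "(\<Sum>f\<in>boundary_facets_on \<Omega> T \<Gamma>. inner_surf f (normal_trace \<Omega> v) (normal_trace \<Omega> v))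
    \<le> inner_surf \<Gamma> (normal_trace \<Omega> v) (normal_trace \<Omega> v)"
proof -
  let ?G = "\<lambda>x. normal_trace \<Omega> v x * normal_trace \<Omega> v x"
  let ?B = "boundary_facets_on \<Omega> T \<Gamma>"
  have B: "f \<in> facets" "f \<subseteq> frontier \<Omega>" "rel_interior f \<subseteq> \<Gamma>" if "f \<in> ?B" for f
    using that by (auto simp: boundary_facets_on_def facets_def)
  have fin: "finite ?B" by (rule finite_subset[OF _ finite_facets]) (use B in blast)
  \<comment> \<open>All facets are taken here: one that crosses the interface of the two boundary
    parts is not in \<open>?B\<close>, yet may contain a piece of \<Gamma>.\<close>
  have "\<Gamma> = (\<Union>f\<in>facets. \<Gamma> \<inter> f)" using \<Gamma>(2) frontier_covered by blast
  moreover have "set_integrable surface_measure (\<Union>f\<in>facets. \<Gamma> \<inter> f) ?G"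
    using \<Gamma> rel_interior_facet_sets
    by (intro set_integrable_UN finite_facets trace_integrable_on_facet) auto
  ultimately have int\<Gamma>: "set_integrable surface_measure \<Gamma> ?G" by simp
  have intf: "set_integrable surface_measure f ?G" if "f \<in> ?B" for f
    using trace_integrable_on_facet[OF B(1)[OF that], of f] rel_interior_facet_sets[OF B(1)[OF that]]
      B(2)[OF that] by simp
  have intr: "set_integrable surface_measure (rel_interior f) ?G" if "f \<in> ?B" for f
    using set_integrable_subset[OF intf[OF that] rel_interior_facet_sets(2)[OF B(1)[OF that]]
        rel_interior_subset] .
  have "inner_surf f (normal_trace \<Omega> v) (normal_trace \<Omega> v) = (LINT x:rel_interior f|surface_measure. ?G x)"
    if f: "f \<in> ?B" for f
    unfolding inner_surf_def
  proof (rule set_integral_cong_set)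
    show "AE x in surface_measure. x \<in> rel_interior f \<longleftrightarrow> x \<in> f"
      by (rule AE_I'[OF rel_frontier_facet_null[OF B(1)[OF f]]])
        (use rel_interior_facet_sets(3)[OF B(1)[OF f]] in auto)
  qed (use intf[OF f] intr[OF f] in
      \<open>auto simp: set_integrable_def set_borel_measurable_def intro: borel_measurable_integrable\<close>)
  then have "(\<Sum>f\<in>?B. inner_surf f (normal_trace \<Omega> v) (normal_trace \<Omega> v))
      = (\<Sum>f\<in>?B. LINT x:rel_interior f|surface_measure. ?G x)" by simp
  also have "\<dots> = (LINT x:(\<Union>f\<in>?B. rel_interior f)|surface_measure. ?G x)"
  proof (rule set_integral_finite_Union[symmetric])
    show "disjoint_family_on rel_interior ?B"
      unfolding disjoint_family_on_def
    proof (intro ballI impI)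
      fix f f' assume ff: "f \<in> ?B" "f' \<in> ?B" "f \<noteq> f'"
      then show "rel_interior f \<inter> rel_interior f' = {}"
        using boundary_facets_eq[OF B(1)[OF ff(1)] B(1)[OF ff(2)]] B(2)[OF ff(1)]
          rel_interior_subset by blast
    qed
  qed (use fin intr rel_interior_facet_sets B in auto)
  also have "\<dots> \<le> (LINT x:\<Gamma>|surface_measure. ?G x)"
    unfolding set_lebesgue_integral_def
  proof (rule integral_mono)
    have "set_integrable surface_measure (\<Union>f\<in>?B. rel_interior f) ?G"
      using fin intr rel_interior_facet_sets B by (intro set_integrable_UN) auto
    then show "integrable surface_measure (\<lambda>x. indicator (\<Union>f\<in>?B. rel_interior f) x *\<^sub>R ?G x)"
      by (simp add: set_integrable_def)
    show "integrable surface_measure (\<lambda>x. indicator \<Gamma> x *\<^sub>R ?G x)"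
      using int\<Gamma> by (simp add: set_integrable_def)
    show "indicator (\<Union>f\<in>?B. rel_interior f) x *\<^sub>R ?G x \<le> indicator \<Gamma> x *\<^sub>R ?G x" for x
      using B(3) by (auto simp: indicator_def)
  qed
  finally show ?thesis by (simp add: inner_surf_def)
qed

lemma norm_0_le_form_a:
  assumes "\<Gamma> \<in> sets surface_measure" "\<Gamma> \<subseteq> frontier \<Omega>" "s > 0"
  shows "(norm_0 \<Omega> T \<Gamma> s v)\<^sup>2 \<le> form_a \<Omega> \<Gamma> s v v"
proof -
  \<comment> \<open>Nonnegativity lets squaring undo the square roots in the norms. It holds without
    integrability, since the default value 0 of the integral is nonnegative.\<close>
  have vol: "inner_vol \<Omega> v v \<ge> 0"
    unfolding inner_vol_def set_lebesgue_integral_def by (intro integral_nonneg_AE) auto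
  have surf: "inner_surf f p p \<ge> 0" for f :: "(real^'n) set" and p
    unfolding inner_surf_def set_lebesgue_integral_def by (intro integral_nonneg_AE) auto
  have "(norm_0 \<Omega> T \<Gamma> s v)\<^sup>2 = inner_vol \<Omega> v v + inverse s *
      (\<Sum>f\<in>boundary_facets_on \<Omega> T \<Gamma>. inner_surf f (normal_trace \<Omega> v) (normal_trace \<Omega> v))"
    using vol surf assms(3)
    by (simp add: norm_0_def norm_vol_def norm_surf_def sum_distrib_left sum_nonneg)
  also have "\<dots> \<le> form_a \<Omega> \<Gamma> s v v"
    unfolding form_a_def using sum_facet_traces_le[OF assms(1,2)] assms(3)
    by (intro add_left_mono mult_left_mono) auto
  finally show ?thesis .
qed

end

end

section \<open>Affine cells and Raviart-Thomas fields\<close>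

text \<open>Both reference cells are polytopes with interior points, and an invertible affine map
  preserves these properties.\<close>

lemma
  assumes "is_cell_map c K B b"
  shows polytope_cell_map: "polytope K"
    and interior_cell_map: "interior K \<noteq> {}"
proof -
  have ref: "polytope (reference_cell c :: (real^'n) set)" "interior (reference_cell c :: (real^'n) set) \<noteq> {}"
    by (cases c; use interior_std_simplex_nonempty[where 'a="real^'n"] in
        \<open>force simp: polytope_convex_hull polytope_interval interior_cbox box_ne_empty\<close>)+
  have K: "K = (+) b ` ((*v) B ` reference_cell c)" and "invertible B"
    using assms by (auto simp: is_cell_map_def affine_map_def image_image add.commute)
  then have "inj ((*v) B)" by (simp add: inj_matrix_vector_mult)
  show "polytope K"
    unfolding K polytope_translation_eq
    by (rule polytope_linear_image[OF matrix_vector_mul_linear ref(1)])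
  show "interior K \<noteq> {}"
    unfolding K interior_translation
    using interior_injective_linear_image[OF matrix_vector_mul_linear \<open>inj ((*v) B)\<close>] ref(2) by simp
qed

lemma continuous_polys_with_exponents:
  "p \<in> polys_with_exponents E \<Longrightarrow> continuous_on UNIV p"
  by (auto simp: polys_with_exponents_def intro!: continuous_intros)

text \<open>Reference fields have polynomial components, and the Piola transform composes them with
  continuous maps. This supplies the continuous extension of \<open>v\<close> from a cell interior
  to the whole space.\<close>

lemma continuous_RT_cell:
  fixes B :: "real^'n^'n"
  assumes "invertible B" "w \<in> RT_cell c k B b"
  shows "continuous_on UNIV w"
proof -
  obtain u where u: "u \<in> RT_ref c k" "w = piola B b u" using assms(2) by (auto simp: RT_cell_def)
  have cu: "continuous_on UNIV u"
  proof (cases c)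
    case Simplicial
    then obtain p q where pq: "u = (\<lambda>x. p x + q x *\<^sub>R x)" "\<And>i. (\<lambda>x. p x $ i) \<in> polyP k" "q \<in> polyP_hom k"
      using u(1) by auto
    have "continuous_on UNIV (\<lambda>x. \<chi> i. p x $ i)"
      using pq(2) by (intro continuous_on_vec_lambda continuous_polys_with_exponents)
        (auto simp: polyP_def)
    then have "continuous_on UNIV p" by simp
    moreover have "continuous_on UNIV q"
      using pq(3) by (auto simp: polyP_hom_def intro: continuous_polys_with_exponents)
    ultimately show ?thesis unfolding pq(1) by (intro continuous_intros)
  next
    case Cubical
    have "continuous_on UNIV (\<lambda>x. \<chi> i. u x $ i)"
      using u(1) Cubical by (intro continuous_on_vec_lambda)
        (auto simp: polyQ_def intro!: continuous_polys_with_exponents)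
    then show ?thesis by simp
  qed
  obtain C where C: "B ** C = mat 1" "C ** B = mat 1"
    using assms(1) unfolding invertible_def by blast
  have "inv (affine_map B b) = (\<lambda>y. C *v (y - b))"
    using C
    by (intro inv_equality) (simp_all add: affine_map_def matrix_vector_mul_assoc)
  then have "continuous_on UNIV (inv (affine_map B b))"
    by (auto intro!: linear_continuous_on_compose[OF _ matrix_vector_mul_linear] continuous_intros)
  then have "continuous_on UNIV (\<lambda>x. u (inv (affine_map B b) x))"
    by (rule continuous_on_compose2[OF cu]) simp
  then show ?thesis
    unfolding u(2) piola_def
    by (intro continuous_intros linear_continuous_on_compose[OF _ matrix_vector_mul_linear])
qed

theorem proposition4p2:
  fixes \<Omega> \<Gamma>\<^sub>N \<Gamma>\<^sub>D :: "(real^'n) set"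
    and c :: cell_type
    and k :: nat
    and H :: "real set"
    and T :: "real \<Rightarrow> (real^'n) set set"
    and B :: "real \<Rightarrow> (real^'n) set \<Rightarrow> real^'n^'n"
    and b :: "real \<Rightarrow> (real^'n) set \<Rightarrow> real^'n"
  assumes "CARD('n) \<in> {2, 3}"
    and "open \<Omega>" and "connected \<Omega>" and "bounded \<Omega>" and "lipschitz_boundary \<Omega>"
    and "frontier \<Omega> = \<Gamma>\<^sub>N \<union> \<Gamma>\<^sub>D" and "\<Gamma>\<^sub>N \<inter> \<Gamma>\<^sub>D = {}"
    and "\<Gamma>\<^sub>N \<in> sets surface_measure"
    and "H \<subseteq> {0<..}"
    and "\<And>h. h \<in> H \<Longrightarrow> mesh_of c \<Omega> (T h) (B h) (b h)"
    and "\<And>h. h \<in> H \<Longrightarrow> h = mesh_size (T h)"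
    and "shape_regular H T"
    and "quasi_uniform H T"
  shows "\<exists>\<alpha>\<^sub>h>0. \<exists>\<alpha>\<^sub>\<epsilon>>0. \<forall>h\<in>H. \<forall>\<epsilon>>0.
    (\<forall>v\<in>RT_space c k \<Omega> (T h) (B h) (b h).
      form_a \<Omega> \<Gamma>\<^sub>N h v v \<ge> \<alpha>\<^sub>h * (norm_0 \<Omega> (T h) \<Gamma>\<^sub>N h v)\<^sup>2) \<and>
    (\<forall>v\<in>RT_space c k \<Omega> (T h) (B h) (b h).
      form_a \<Omega> \<Gamma>\<^sub>N \<epsilon> v v \<ge> \<alpha>\<^sub>\<epsilon> * (norm_0 \<Omega> (T h) \<Gamma>\<^sub>N \<epsilon> v)\<^sup>2)"
proof -
  \<comment> \<open>One estimate with a free weight \<open>s\<close> yields both claims, for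
    \<open>s = h\<close> and for \<open>s = \<epsilon>\<close>.\<close>
  have "(norm_0 \<Omega> (T h) \<Gamma>\<^sub>N s v)\<^sup>2 \<le> form_a \<Omega> \<Gamma>\<^sub>N s v v"
    if h: "h \<in> H" and s: "s > 0" and v: "v \<in> RT_space c k \<Omega> (T h) (B h) (b h)" for h s v
  proof -
    note mesh = assms(10)[OF h, unfolded mesh_of_def]
    interpret polytopal_mesh \<Omega> "T h"
    proof
      show "interior (closure \<Omega>) \<subseteq> \<Omega>" using assms(2,5) by (rule lipschitz_interior_closure)
    qed (use assms(2) mesh polytope_cell_map interior_cell_map in blast)+
    show ?thesis
    proof (rule norm_0_le_form_a)
      fix K assume K: "K \<in> T h"
      then have "invertible (B h K)" using mesh by (auto simp: is_cell_map_def)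
      then show "\<exists>w. continuous_on UNIV w \<and> (\<forall>x\<in>interior K. v x = w x)"
        using v K continuous_RT_cell unfolding RT_space_def by blast
    qed (use assms(6,8) s in auto)
  qed
  moreover have "h > 0" if "h \<in> H" for h using that assms(9) by auto
  ultimately show ?thesis by (intro exI[of _ "1::real"] conjI ballI allI impI) simp_all
qed

end
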